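(* Let $\alpha,\beta\in\mathbb{B}_3$ with $\beta=\Delta^{2k}\alpha$ for some integer $k>0$, where $\Delta=\sigma_1\sigma_2\sigma_1$. Then the Conway polynomials of the closures satisfy $$\nabla(\widehat{\beta})-\nabla(\widehat{\alpha})=z\sum_{i=0}^{k-1}\left(F_{e_\alpha+6i+4}+F_{e_\alpha+6i+2}\right),$$ where $F_n=F_n(z)$ is the $n$-th Fibonacci polynomial ($n\in\mathbb{Z}$) and $e_\alpha$ is the exponent sum of $\alpha$.
   Context: $\mathbb{B}_3=\langle\sigma_1,\sigma_2\mid\sigma_1\sigma_2\sigma_1=\sigma_2\sigma_1\sigma_2\rangle$ is the braid group on 3 strands. The closure $\widehat{\alpha}$ of a braid $\alpha$ is an oriented link with all strands oriented in parallel, with the convention that each $\sigma_i$ gives a positive crossing. The exponent sum $e_\alpha\in\mathbb{Z}$ is the image of $\alpha$ under the homomorphism $\mathbb{B}_3\to\mathbb{Z}$ sending each $\sigma_i$ to $1$. The Conway polynomial $\nabla(L)\in\mathbb{Z}[z]$ of an oriented link is the invariant determined by $\nabla(\text{unknot})=1$ and the skein relation $\nabla(L_+)-\nabla(L_-)=z\nabla(L_0)$, where $L_+,L_-,L_0$ have diagrams identical outside a small disc, inside which they have respectively a positive crossing, a negative crossing, and the oriented smoothing. The Fibonacci polynomials are defined by $F_0(z)=0$, $F_1(z)=1$, $F_n(z)=zF_{n-1}(z)+F_{n-2}(z)$ for $n\ge 2$, and extended to negative indices by $F_{-n}(z)=(-1)^{n+1}F_n(z)$. *)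

theory Defs
  imports "HOL-Computational_Algebra.Polynomial"
begin

section \<open>Oriented links\<close>

text \<open>
  An oriented link diagram in general position with respect to the height function is cut by
  horizontal lines into layers, each containing a single local minimum (\<open>Cup\<close>), local maximum
  (\<open>Cap\<close>) or crossing (\<open>Cross\<close>).  Diagrams are read from bottom to top.  A layer \<open>(i, p)\<close> consists
  of the piece \<open>p\<close> with exactly \<open>i\<close> vertical strands to its left.

  The strands met by a horizontal line are recorded, from left to right, by their directions,
  \<open>True\<close> meaning upwards.  In \<open>Cup u\<close>, the direction of the left leg is \<open>u\<close>.  In \<open>Cross s\<close>, the
  strand running from bottom left to top right is the over-strand if \<open>s\<close>, and the strand running
  from bottom right to top left is the over-strand otherwise.
\<close>

datatype piece = Cup bool | Cap | Cross bool

type_synonym layer = "nat \<times> piece"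

fun inputs :: "piece \<Rightarrow> nat" where
  "inputs (Cup u) = 0"
| "inputs Cap = 2"
| "inputs (Cross s) = 2"

fun outputs :: "piece \<Rightarrow> nat" where
  "outputs (Cup u) = 2"
| "outputs Cap = 0"
| "outputs (Cross s) = 2"

fun pass_layer :: "layer \<Rightarrow> bool list \<Rightarrow> bool list option" where
  "pass_layer (i, Cup u) ds =
     (if i \<le> length ds then Some (take i ds @ [u, \<not> u] @ drop i ds) else None)"
| "pass_layer (i, Cap) ds =
     (if Suc i < length ds \<and> ds ! i \<noteq> ds ! Suc i
      then Some (take i ds @ drop (i + 2) ds) else None)"
| "pass_layer (i, Cross s) ds =
     (if Suc i < length ds
      then Some (take i ds @ [ds ! Suc i, ds ! i] @ drop (i + 2) ds) else None)"

fun pass :: "layer list \<Rightarrow> bool list \<Rightarrow> bool list option" where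
  "pass [] ds = Some ds"
| "pass (l # w) ds = Option.bind (pass_layer l ds) (pass w)"

definition link_diagram :: "layer list \<Rightarrow> bool" where
  "link_diagram w \<longleftrightarrow> w \<noteq> [] \<and> pass w [] = Some []"

text \<open>
  The local moves: planar isotopy (exchanging the heights of two pieces lying side by side,
  straightening a bent strand, moving a strand over or under a local extremum) and the three
  Reidemeister moves.  The orientations and the positions are constrained only by the
  requirement, in \<open>move\<close>, that both sides be parts of link diagrams.  In \<open>r3\<close> the premise
  excludes exactly the configurations in which the three strands lie cyclically above one another.
\<close>

inductive local_move :: "layer list \<Rightarrow> layer list \<Rightarrow> bool" where
  exchange: "local_move [(i, p), (i + outputs p + m, q)] [(i + inputs p + m, q), (i, p)]"
| straighten_left: "local_move [(i, Cup u), (Suc i, Cap)] []"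
| straighten_right: "local_move [(Suc i, Cup u), (i, Cap)] []"
| slide_cap: "local_move [(i, Cross s), (Suc i, Cap)] [(Suc i, Cross (\<not> s)), (i, Cap)]"
| slide_cup: "local_move [(i, Cup u), (Suc i, Cross s)] [(Suc i, Cup u), (i, Cross (\<not> s))]"
| r1_right: "local_move [(Suc i, Cup u), (i, Cross s), (Suc i, Cap)] []"
| r1_left: "local_move [(i, Cup u), (Suc i, Cross s), (i, Cap)] []"
| r2: "local_move [(i, Cross s), (i, Cross (\<not> s))] []"
| r3: "s = t \<or> t = r \<Longrightarrow>
    local_move [(i, Cross s), (Suc i, Cross t), (i, Cross r)]
               [(Suc i, Cross r), (i, Cross t), (Suc i, Cross s)]"

inductive move :: "layer list \<Rightarrow> layer list \<Rightarrow> bool" where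
  "local_move l r \<Longrightarrow> link_diagram (u @ l @ v) \<Longrightarrow> link_diagram (u @ r @ v)
    \<Longrightarrow> move (u @ l @ v) (u @ r @ v)"

definition isotopic :: "layer list \<Rightarrow> layer list \<Rightarrow> bool" where
  "isotopic w w' \<longleftrightarrow> link_diagram w \<and> link_diagram w' \<and> equivclp move w w'"

lemma isotopic_refl: "link_diagram w \<Longrightarrow> isotopic w w"
  by (simp add: isotopic_def)

lemma isotopic_sym: "isotopic w w' \<Longrightarrow> isotopic w' w"
  by (auto simp: isotopic_def intro: equivclp_sym)

lemma isotopic_trans: "isotopic w w' \<Longrightarrow> isotopic w' w'' \<Longrightarrow> isotopic w w''"
  by (auto simp: isotopic_def intro: equivclp_trans)

lemma link_diagram_unknot: "link_diagram [(0, Cup True), (0, Cap)]"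
  by (simp add: link_diagram_def)

quotient_type oriented_link = "layer list" / partial: isotopic
  morphisms diagram_of link_of
proof (rule part_equivpI)
  show "\<exists>w. isotopic w w"
    using isotopic_refl[OF link_diagram_unknot] by blast
  show "symp isotopic"
    by (auto intro: sympI isotopic_sym)
  show "transp isotopic"
    by (blast intro: transpI isotopic_trans)
qed

definition unknot :: oriented_link where
  "unknot = link_of [(0, Cup True), (0, Cap)]"

section \<open>The Conway polynomial\<close>

text \<open>
  In \<open>skein_triple D\<^sub>+ D\<^sub>- D\<^sub>0\<close> the three diagrams agree except at one crossing, which is positive,
  negative and smoothed according to the orientation, respectively.  A crossing of two strands
  that both run upwards or both run downwards is positive iff the strand from bottom left to top
  right is the over-strand, and its oriented smoothing consists of two vertical strands.  If one
  strand runs upwards and the other one downwards, the sign is reversed and the oriented smoothing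
  consists of a maximum below a minimum.
\<close>

inductive skein_triple :: "layer list \<Rightarrow> layer list \<Rightarrow> layer list \<Rightarrow> bool" where
  parallel:
    "pass u [] = Some ds \<Longrightarrow> Suc i < length ds \<Longrightarrow> ds ! i = ds ! Suc i
      \<Longrightarrow> link_diagram (u @ [(i, Cross True)] @ v)
      \<Longrightarrow> skein_triple (u @ [(i, Cross True)] @ v) (u @ [(i, Cross False)] @ v) (u @ v)"
| antiparallel:
    "pass u [] = Some ds \<Longrightarrow> Suc i < length ds \<Longrightarrow> ds ! i \<noteq> ds ! Suc i
      \<Longrightarrow> link_diagram (u @ [(i, Cross False)] @ v)
      \<Longrightarrow> skein_triple (u @ [(i, Cross False)] @ v) (u @ [(i, Cross True)] @ v)
            (u @ [(i, Cap), (i, Cup (ds ! Suc i))] @ v)"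

abbreviation z_poly :: "int poly" where
  "z_poly \<equiv> [:0, 1:]"

definition is_conway_polynomial :: "(oriented_link \<Rightarrow> int poly) \<Rightarrow> bool" where
  "is_conway_polynomial nabla \<longleftrightarrow>
     nabla unknot = 1 \<and>
     (\<forall>Dp Dm D0. skein_triple Dp Dm D0 \<longrightarrow>
        nabla (link_of Dp) - nabla (link_of Dm) = z_poly * nabla (link_of D0))"

section \<open>The braid group on three strands\<close>

datatype gen = S1 | S2

text \<open>The letter \<open>(g, True)\<close> stands for the generator \<open>g\<close> and \<open>(g, False)\<close> for its inverse.\<close>

type_synonym braid_word = "(gen \<times> bool) list"

inductive braid_eq :: "braid_word \<Rightarrow> braid_word \<Rightarrow> bool" where
  refl: "braid_eq w w"
| sym: "braid_eq w w' \<Longrightarrow> braid_eq w' w"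
| trans: "braid_eq w w' \<Longrightarrow> braid_eq w' w'' \<Longrightarrow> braid_eq w w''"
| cancel: "braid_eq (u @ [(g, s), (g, \<not> s)] @ v) (u @ v)"
| braid: "braid_eq (u @ [(S1, True), (S2, True), (S1, True)] @ v)
                   (u @ [(S2, True), (S1, True), (S2, True)] @ v)"

lemma braid_eq_context: "braid_eq w w' \<Longrightarrow> braid_eq (u @ w @ v) (u @ w' @ v)"
proof (induction rule: braid_eq.induct)
  case (cancel u' g s v')
  show ?case using braid_eq.cancel[of "u @ u'" g s "v' @ v"] by simp
next
  case (braid u' v')
  show ?case using braid_eq.braid[of "u @ u'" "v' @ v"] by simp
qed (auto intro: braid_eq.refl braid_eq.sym braid_eq.trans)

definition inverse_word :: "braid_word \<Rightarrow> braid_word" where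
  "inverse_word w = rev (map (\<lambda>(g, s). (g, \<not> s)) w)"

lemma braid_eq_inverse_right: "braid_eq (w @ inverse_word w) []"
proof (induction w)
  case Nil
  show ?case by (simp add: inverse_word_def braid_eq.refl)
next
  case (Cons a w)
  obtain g s where a: "a = (g, s)" by (cases a)
  have "braid_eq ([a] @ (w @ inverse_word w) @ [(g, \<not> s)]) ([a] @ [] @ [(g, \<not> s)])"
    using Cons.IH by (rule braid_eq_context)
  moreover have "braid_eq ([a] @ [] @ [(g, \<not> s)]) []"
    using braid_eq.cancel[of "[]" g s "[]"] a by simp
  ultimately show ?case
    using a by (auto simp: inverse_word_def intro: braid_eq.trans)
qed

lemma inverse_inverse_word: "inverse_word (inverse_word w) = w"
  by (induction w) (auto simp: inverse_word_def)

lemma braid_eq_inverse_left: "braid_eq (inverse_word w @ w) []"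
  using braid_eq_inverse_right[of "inverse_word w"] by (simp add: inverse_inverse_word)

lemma braid_eq_append:
  "braid_eq w1 w1' \<Longrightarrow> braid_eq w2 w2' \<Longrightarrow> braid_eq (w1 @ w2) (w1' @ w2')"
  using braid_eq_context[of w1 w1' "[]" w2] braid_eq_context[of w2 w2' w1' "[]"]
  by (auto intro: braid_eq.trans)

lemma braid_eq_inverse:
  assumes "braid_eq w w'"
  shows "braid_eq (inverse_word w) (inverse_word w')"
proof -
  have "braid_eq (inverse_word w @ w' @ inverse_word w') (inverse_word w)"
    using braid_eq_context[OF braid_eq_inverse_right[of w'], of "inverse_word w" "[]"] by simp
  moreover have "braid_eq (inverse_word w @ w @ inverse_word w')
                          (inverse_word w @ w' @ inverse_word w')"
    using assms by (rule braid_eq_context)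
  moreover have "braid_eq (inverse_word w @ w @ inverse_word w') (inverse_word w')"
    using braid_eq_context[OF braid_eq_inverse_left[of w], of "[]" "inverse_word w'"] by simp
  ultimately show ?thesis
    by (meson braid_eq.sym braid_eq.trans)
qed

quotient_type braid3 = braid_word / braid_eq
  by (auto intro!: equivpI reflpI sympI transpI intro: braid_eq.refl braid_eq.sym braid_eq.trans)

instantiation braid3 :: "{monoid_mult, inverse}"
begin

lift_definition one_braid3 :: braid3 is "[]" .

lift_definition times_braid3 :: "braid3 \<Rightarrow> braid3 \<Rightarrow> braid3" is "(@)"
  by (rule braid_eq_append)

lift_definition inverse_braid3 :: "braid3 \<Rightarrow> braid3" is inverse_word
  by (rule braid_eq_inverse)

definition divide_braid3 :: "braid3 \<Rightarrow> braid3 \<Rightarrow> braid3" where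
  "divide_braid3 a b = a * inverse b"

instance
proof
  fix a b c :: braid3
  show "a * b * c = a * (b * c)" by transfer (simp add: braid_eq.refl)
  show "1 * a = a" by transfer (simp add: braid_eq.refl)
  show "a * 1 = a" by transfer (simp add: braid_eq.refl)
qed

end

lemma braid3_left_inverse: "inverse a * a = (1 :: braid3)"
  by transfer (rule braid_eq_inverse_left)

lift_definition \<sigma>\<^sub>1 :: braid3 is "[(S1, True)]" .

lift_definition \<sigma>\<^sub>2 :: braid3 is "[(S2, True)]" .

lemma braid3_relation: "\<sigma>\<^sub>1 * \<sigma>\<^sub>2 * \<sigma>\<^sub>1 = \<sigma>\<^sub>2 * \<sigma>\<^sub>1 * \<sigma>\<^sub>2"
  by transfer (use braid_eq.braid[of "[]" "[]"] in simp)

definition \<Delta> :: braid3 where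
  "\<Delta> = \<sigma>\<^sub>1 * \<sigma>\<^sub>2 * \<sigma>\<^sub>1"

lift_definition exponent_sum :: "braid3 \<Rightarrow> int"
  is "\<lambda>w. \<Sum>(g, s)\<leftarrow>w. if s then 1 else - 1"
  by (erule braid_eq.induct) auto

lemma exponent_sum_hom: "exponent_sum (a * b) = exponent_sum a + exponent_sum b"
  by transfer simp

lemma exponent_sum_gen: "exponent_sum \<sigma>\<^sub>1 = 1" "exponent_sum \<sigma>\<^sub>2 = 1"
  by (transfer, simp)+

section \<open>The closure of a braid\<close>

text \<open>
  The braid runs upwards on the three leftmost strands; the closing arcs are nested to its right.
\<close>

fun gen_pos :: "gen \<Rightarrow> nat" where
  "gen_pos S1 = 0"
| "gen_pos S2 = 1"

definition braid_layers :: "braid_word \<Rightarrow> layer list" where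
  "braid_layers w = map (\<lambda>(g, s). (gen_pos g, Cross s)) w"

definition closure_diagram :: "braid_word \<Rightarrow> layer list" where
  "closure_diagram w =
     [(0, Cup True), (1, Cup True), (2, Cup True)] @ braid_layers w @ [(2, Cap), (1, Cap), (0, Cap)]"

lemma pass_append: "pass (u @ v) ds = Option.bind (pass u ds) (pass v)"
proof (induction u arbitrary: ds)
  case (Cons l u)
  then show ?case by (cases "pass_layer l ds") auto
qed simp

lemma pass_braid_layers:
  "pass (braid_layers w) [True, True, True, False, False, False] =
     Some [True, True, True, False, False, False]"
proof (induction w)
  case (Cons a w)
  obtain g s where "a = (g, s)" by (cases a)
  with Cons show ?case by (cases g) (auto simp: braid_layers_def)
qed (simp add: braid_layers_def)

lemma link_diagram_closure: "link_diagram (closure_diagram w)"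
  by (simp add: link_diagram_def closure_diagram_def pass_append pass_braid_layers)

lemma closure_local_move:
  assumes "local_move (braid_layers l) (braid_layers r)"
  shows "isotopic (closure_diagram (u @ l @ v)) (closure_diagram (u @ r @ v))"
proof -
  let ?cups = "[(0, Cup True), (1, Cup True), (2, Cup True)]"
  let ?caps = "[(2, Cap), (1, Cap), (0, Cap)]"
  have eq: "closure_diagram (u @ x @ v) =
      (?cups @ braid_layers u) @ braid_layers x @ (braid_layers v @ ?caps)" for x
    by (simp add: closure_diagram_def braid_layers_def)
  have "move (closure_diagram (u @ l @ v)) (closure_diagram (u @ r @ v))"
    using move.intros[OF assms] link_diagram_closure[of "u @ l @ v"]
      link_diagram_closure[of "u @ r @ v"]
    unfolding eq by blast
  then show ?thesis
    by (auto simp: isotopic_def link_diagram_closure)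
qed

lemma isotopic_closure:
  "braid_eq w w' \<Longrightarrow> isotopic (closure_diagram w) (closure_diagram w')"
proof (induction rule: braid_eq.induct)
  case (refl w)
  show ?case by (rule isotopic_refl[OF link_diagram_closure])
next
  case (sym w w')
  then show ?case by (blast intro: isotopic_sym)
next
  case (trans w w' w'')
  then show ?case by (blast intro: isotopic_trans)
next
  case (cancel u g s v)
  have "local_move (braid_layers [(g, s), (g, \<not> s)]) (braid_layers [])"
    by (simp add: braid_layers_def local_move.r2)
  from closure_local_move[OF this, of u v] show ?case by simp
next
  case (braid u v)
  have "local_move (braid_layers [(S1, True), (S2, True), (S1, True)])
                   (braid_layers [(S2, True), (S1, True), (S2, True)])"
    using local_move.r3[of True True True 0] by (simp add: braid_layers_def)
  then show ?case by (rule closure_local_move)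
qed

lift_definition braid_closure :: "braid3 \<Rightarrow> oriented_link" is closure_diagram
  by (rule isotopic_closure)

section \<open>Fibonacci polynomials\<close>

fun fib_poly_nat :: "nat \<Rightarrow> int poly" where
  "fib_poly_nat 0 = 0"
| "fib_poly_nat (Suc 0) = 1"
| "fib_poly_nat (Suc (Suc n)) = z_poly * fib_poly_nat (Suc n) + fib_poly_nat n"

definition fib_poly :: "int \<Rightarrow> int poly" where
  "fib_poly n =
     (if n \<ge> 0 then fib_poly_nat (nat n)
      else (- 1) ^ (nat (- n) + 1) * fib_poly_nat (nat (- n)))"

end

theory Submission
  imports Defs
begin

text \<open>
  Call a function on \<open>B\<^sub>3\<close> a skein function if it satisfies the skein relation at every crossing.
  Such a function is a linear functional on the Hecke algebra of \<open>B\<^sub>3\<close>, which is spanned by the six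
  permutation braids, so it is determined by its values on these.  Both
  \<open>\<alpha> \<mapsto> \<nabla>(closure of \<Delta>\<^sup>2 \<alpha>) - \<nabla>(closure of \<alpha>)\<close> and \<open>\<alpha> \<mapsto> z (F\<^bsub>e+4\<^esub> + F\<^bsub>e+2\<^esub>)\<close> are skein functions;
  comparing six values settles \<open>k = 1\<close>, and the general case follows by telescoping.  All values of
  \<open>\<nabla>\<close> needed come from destabilization: a word containing \<open>\<sigma>\<^sub>2\<close> exactly once, with either sign,
  can be reduced to a closed 2-braid by a Reidemeister I move.
\<close>

section \<open>Skein functions on the braid group\<close>

text \<open>Two-sided contexts put the crossing anywhere in a braid word; products nest to the right
  because later rewriting normalizes with \<open>mult.assoc\<close>.\<close>

definition skein_function :: "'a::comm_ring_1 \<Rightarrow> (braid3 \<Rightarrow> 'a) \<Rightarrow> bool" where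
  "skein_function z f \<longleftrightarrow>
     (\<forall>a b. \<forall>g\<in>{\<sigma>\<^sub>1, \<sigma>\<^sub>2}. f (a * (g * b)) - f (a * (inverse g * b)) = z * f (a * b))"

abbreviation permutation_braids :: "braid3 set" where
  "permutation_braids \<equiv> {1, \<sigma>\<^sub>1, \<sigma>\<^sub>2, \<sigma>\<^sub>1 * \<sigma>\<^sub>2, \<sigma>\<^sub>2 * \<sigma>\<^sub>1, \<sigma>\<^sub>1 * (\<sigma>\<^sub>2 * \<sigma>\<^sub>1)}"

text \<open>The trailing \<open>b\<close> lets the braid relation fire inside a right-nested
  product; its direction leads to the representative in \<open>permutation_braids\<close>.\<close>

lemma braid3_relation_left: "\<sigma>\<^sub>2 * (\<sigma>\<^sub>1 * (\<sigma>\<^sub>2 * b)) = \<sigma>\<^sub>1 * (\<sigma>\<^sub>2 * (\<sigma>\<^sub>1 * b))"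
  by (metis braid3_relation mult.assoc)

lemma braid3_relation_right: "\<sigma>\<^sub>2 * (\<sigma>\<^sub>1 * \<sigma>\<^sub>2) = \<sigma>\<^sub>1 * (\<sigma>\<^sub>2 * \<sigma>\<^sub>1)"
  by (metis braid3_relation mult.assoc)

lemma braid3_induct [case_names one mult inverse]:
  assumes "P 1"
    and "\<And>a g. P a \<Longrightarrow> g \<in> {\<sigma>\<^sub>1, \<sigma>\<^sub>2} \<Longrightarrow> P (a * g)"
    and "\<And>a g. P a \<Longrightarrow> g \<in> {\<sigma>\<^sub>1, \<sigma>\<^sub>2} \<Longrightarrow> P (a * inverse g)"
  shows "P a"
proof -
  have "P (abs_braid3 w)" for w
  proof (induction w rule: rev_induct)
    case Nil
    show ?case using assms(1) by (simp add: one_braid3_def)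
  next
    case (snoc x w)
    obtain g s where x: "x = (g, s)" by (cases x)
    have "abs_braid3 (w @ [x]) = abs_braid3 w * abs_braid3 [x]"
      by (simp add: times_braid3.abs_eq)
    moreover have "abs_braid3 [x] \<in> {\<sigma>\<^sub>1, \<sigma>\<^sub>2, inverse \<sigma>\<^sub>1, inverse \<sigma>\<^sub>2}"
      by (cases g; cases s)
        (simp_all add: x \<sigma>\<^sub>1_def \<sigma>\<^sub>2_def inverse_braid3.abs_eq inverse_word_def)
    ultimately show ?case using assms(2,3) snoc by auto
  qed
  then show ?thesis by (metis Quotient3_abs_rep Quotient3_braid3)
qed

lemma skein_inverse:
  assumes "skein_function z f" "g \<in> {\<sigma>\<^sub>1, \<sigma>\<^sub>2}"
  shows "f (a * (inverse g * b)) = f (a * (g * b)) - z * f (a * b)"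
proof -
  have "f (a * (g * b)) - f (a * (inverse g * b)) = z * f (a * b)"
    using assms unfolding skein_function_def by blast
  then show ?thesis by (simp add: algebra_simps)
qed

text \<open>This is the quadratic Hecke relation, obtained from the skein relation at the first
  \<open>g\<close>.\<close>

lemma skein_square:
  assumes "skein_function z f" "g \<in> {\<sigma>\<^sub>1, \<sigma>\<^sub>2}"
  shows "f (a * (g * (g * b))) = f (a * b) + z * f (a * (g * b))"
proof -
  have "inverse g * (g * b) = b"
    by (metis braid3_left_inverse mult.assoc mult_1_left)
  then show ?thesis using skein_inverse[OF assms, of a "g * b"] by simp
qed

lemma skein_squares:
  assumes "skein_function z f"
  shows "f (a * (\<sigma>\<^sub>1 * (\<sigma>\<^sub>1 * b))) = f (a * b) + z * f (a * (\<sigma>\<^sub>1 * b))"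
    and "f (a * (\<sigma>\<^sub>2 * (\<sigma>\<^sub>2 * b))) = f (a * b) + z * f (a * (\<sigma>\<^sub>2 * b))"
    and "f (a * (\<sigma>\<^sub>1 * \<sigma>\<^sub>1)) = f a + z * f (a * \<sigma>\<^sub>1)"
    and "f (a * (\<sigma>\<^sub>2 * \<sigma>\<^sub>2)) = f a + z * f (a * \<sigma>\<^sub>2)"
  using skein_square[OF assms, of _ a] skein_square[OF assms, of _ a 1] by auto

text \<open>The induction carries agreement on \<open>a * b\<close> for all six \<open>b\<close> at
  once: the span of the permutation braids is closed under left multiplication by generators, so
  \<open>a * (g * b)\<close> expands into such terms.\<close>

lemma skein_function_unique:
  assumes f: "skein_function z f" and f': "skein_function z f'"
    and eq: "\<And>b. b \<in> permutation_braids \<Longrightarrow> f b = f' b"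
  shows "f a = f' a"
proof -
  have step: "f (a * g * b) = f' (a * g * b)"
    if "\<forall>b\<in>permutation_braids. f (a * b) = f' (a * b)"
      and "g \<in> {\<sigma>\<^sub>1, \<sigma>\<^sub>2}" and "b \<in> permutation_braids" for a g b
    \<comment> \<open>In the case \<open>\<sigma>\<^sub>2 * (\<sigma>\<^sub>1 * (\<sigma>\<^sub>2 *
      \<sigma>\<^sub>1))\<close> the braid relation puts a square at the end, behind the prefix
      \<open>a * (\<sigma>\<^sub>1 * \<sigma>\<^sub>2)\<close>.\<close>
    using that
    by (auto simp: mult.assoc skein_squares[OF f] skein_squares[OF f']
        skein_squares(3)[OF f, of "a * (\<sigma>\<^sub>1 * \<sigma>\<^sub>2)", unfolded mult.assoc]
        skein_squares(3)[OF f', of "a * (\<sigma>\<^sub>1 * \<sigma>\<^sub>2)", unfolded mult.assoc]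
        braid3_relation_left braid3_relation_right)
  have "\<forall>b\<in>permutation_braids. f (a * b) = f' (a * b)"
  proof (induction a rule: braid3_induct)
    case one
    show ?case using eq by simp
  next
    case (mult a g)
    then show ?case using step by blast
  next
    case (inverse a g)
    have "f (a * inverse g * b) = f' (a * inverse g * b)" if "b \<in> permutation_braids" for b
      using step[OF inverse that] inverse(1) that
      by (simp only: mult.assoc skein_inverse[OF f inverse(2)] skein_inverse[OF f' inverse(2)])
    then show ?case by blast
  qed
  then show ?thesis by (metis insertI1 mult_1_right)
qed

lemma skein_function_diff:
  assumes "skein_function z f" "skein_function z f'"
  shows "skein_function z (\<lambda>a. f a - f' a)"
  unfolding skein_function_def
proof (intro allI ballI)
  fix a b g assume "g \<in> {\<sigma>\<^sub>1, \<sigma>\<^sub>2}"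
  then show "f (a * (g * b)) - f' (a * (g * b)) - (f (a * (inverse g * b)) - f' (a * (inverse g * b)))
      = z * (f (a * b) - f' (a * b))"
    by (simp only: skein_inverse[OF assms(1)] skein_inverse[OF assms(2)]) (simp add: algebra_simps)
qed

lemma skein_function_translate: "skein_function z f \<Longrightarrow> skein_function z (\<lambda>a. f (c * a))"
  by (simp add: skein_function_def mult.assoc[symmetric])

section \<open>Exponent sums and skein functions that depend on them alone\<close>

lemma exponent_sum_one: "exponent_sum 1 = 0"
  by transfer simp

lemma exponent_sum_inverse: "exponent_sum (inverse a) = - exponent_sum a"
  using exponent_sum_hom[of "inverse a" a] by (simp add: braid3_left_inverse exponent_sum_one)

lemma exponent_sum_power: "exponent_sum (a ^ n) = int n * exponent_sum a"
  by (induction n) (simp_all add: exponent_sum_one exponent_sum_hom algebra_simps)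

lemma exponent_sum_Delta: "exponent_sum \<Delta> = 3"
  by (simp add: \<Delta>_def exponent_sum_hom exponent_sum_gen)

text \<open>The three braids of a skein relation have exponent sums m + 1, m - 1 and m, so the
  relation becomes the recurrence for \<open>F\<close>.\<close>

lemma skein_function_exponent_sum:
  assumes "\<And>n. F (n + 2) = z * F (n + 1) + F n"
  shows "skein_function z (\<lambda>a. F (exponent_sum a))"
proof -
  have "F (n + (1 + l)) - F (n + (- 1 + l)) = z * F (n + l)" for n l
    using assms[of "n + l - 1"] by (simp add: algebra_simps)
  then show ?thesis
    by (auto simp: skein_function_def exponent_sum_hom exponent_sum_inverse exponent_sum_gen)
qed

section \<open>Fibonacci polynomials with integer index\<close>

lemma fib_poly_of_nat: "fib_poly (int n) = fib_poly_nat n"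
  by (simp add: fib_poly_def)

lemma fib_poly_minus: "fib_poly (- int n) = (- 1) ^ (n + 1) * fib_poly_nat n"
  by (cases "n = 0") (simp_all add: fib_poly_def)

lemma fib_poly_rec: "fib_poly (n + 2) = z_poly * fib_poly (n + 1) + fib_poly n"
proof -
  \<comment> \<open>Only at \<open>n = - 1\<close> do the indices have both signs; for
    \<open>n \<le> - 2\<close> all are nonpositive and \<open>fib_poly_minus\<close>, valid at 0
    too, applies.\<close>
  consider m where "n = int m" | "n = - 1" | m where "n = - int (Suc (Suc m))"
  proof (cases "n < - 1")
    case True
    then have "n = - int (Suc (Suc (nat (- n - 2))))" by simp
    then show thesis by (rule that(3))
  next
    case False
    then show thesis using that(1)[of "nat n"] that(2) by linarith
  qed
  then show ?thesis
  proof cases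
    case (1 m)
    have "n + 2 = int (Suc (Suc m))" "n + 1 = int (Suc m)" using 1 by simp_all
    then show ?thesis using 1 by (simp only: fib_poly_of_nat fib_poly_nat.simps)
  next
    case 2
    then show ?thesis by (simp add: fib_poly_def)
  next
    case (3 m)
    have "n + 2 = - int m" "n + 1 = - int (Suc m)" using 3 by simp_all
    then show ?thesis using 3 by (simp only: fib_poly_minus) (simp add: algebra_simps)
  qed
qed

section \<open>Destabilization\<close>

abbreviation crossings :: "bool list \<Rightarrow> layer list" where
  "crossings u \<equiv> map (\<lambda>s. (0, Cross s)) u"

text \<open>Splitting each list in two records how far the innermost minimum and maximum have been
  slid past crossings of the first two strands.\<close>

definition stabilized :: "bool list \<Rightarrow> bool list \<Rightarrow> bool \<Rightarrow> bool list \<Rightarrow> bool list \<Rightarrow> layer list" where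
  "stabilized u u' s v v' =
     [(0, Cup True), (1, Cup True)] @ crossings u @ [(2, Cup True)] @ crossings u' @
     [(1, Cross s)] @ crossings v @ [(2, Cap)] @ crossings v' @ [(1, Cap), (0, Cap)]"

definition closure2 :: "bool list \<Rightarrow> layer list" where
  "closure2 u = [(0, Cup True), (1, Cup True)] @ crossings u @ [(1, Cap), (0, Cap)]"

lemma pass_crossings: "pass (crossings u) (True # True # ds) = Some (True # True # ds)"
  by (induction u) auto

lemma link_diagram_stabilized: "link_diagram (stabilized u u' s v v')"
  by (simp add: link_diagram_def stabilized_def pass_append pass_crossings)

lemma link_diagram_closure2: "link_diagram (closure2 u)"
  by (simp add: link_diagram_def closure2_def pass_append pass_crossings)

lemma isotopic_local_move:
  assumes "local_move l r" "link_diagram (u @ l @ v)" "link_diagram (u @ r @ v)"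
  shows "isotopic (u @ l @ v) (u @ r @ v)"
  using assms move.intros[OF assms] by (auto simp: isotopic_def)

text \<open>The minimum lies to the right of the crossings in \<open>u\<close> and passes them one
  by one by exchanging heights; its neighbour is the last one, hence
  \<open>rev_induct\<close>.\<close>

lemma stabilized_slide_cup: "isotopic (stabilized u u' s v v') (stabilized [] (u @ u') s v v')"
proof (induction u arbitrary: u' rule: rev_induct)
  case Nil
  show ?case by (simp add: isotopic_refl link_diagram_stabilized)
next
  case (snoc t u)
  have "local_move [(0, Cross t), (2, Cup True)] [(2, Cup True), (0, Cross t)]"
    using local_move.exchange[of 0 "Cross t" 0 "Cup True"] by (simp add: numeral_2_eq_2)
  from isotopic_local_move[OF this, of "[(0, Cup True), (1, Cup True)] @ crossings u"
      "crossings u' @ [(1, Cross s)] @ crossings v @ [(2, Cap)] @ crossings v' @ [(1, Cap), (0, Cap)]"]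
  have "isotopic (stabilized (u @ [t]) u' s v v') (stabilized u (t # u') s v v')"
    using link_diagram_stabilized[of "u @ [t]" u' s v v']
      link_diagram_stabilized[of u "t # u'" s v v']
    by (simp add: stabilized_def)
  then show ?case using snoc[of "t # u'"] isotopic_trans by simp
qed

lemma stabilized_slide_cap: "isotopic (stabilized u u' s v v') (stabilized u u' s [] (v @ v'))"
proof (induction v arbitrary: v' rule: rev_induct)
  case Nil
  show ?case by (simp add: isotopic_refl link_diagram_stabilized)
next
  case (snoc t v)
  have "local_move [(0, Cross t), (2, Cap)] [(2, Cap), (0, Cross t)]"
    using local_move.exchange[of 0 "Cross t" 0 Cap] by (simp add: numeral_2_eq_2)
  from isotopic_local_move[OF this, of "[(0, Cup True), (1, Cup True)] @ crossings u @
        [(2, Cup True)] @ crossings u' @ [(1, Cross s)] @ crossings v"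
      "crossings v' @ [(1, Cap), (0, Cap)]"]
  have "isotopic (stabilized u u' s (v @ [t]) v') (stabilized u u' s v (t # v'))"
    using link_diagram_stabilized[of u u' s "v @ [t]" v']
      link_diagram_stabilized[of u u' s v "t # v'"]
    by (simp add: stabilized_def)
  then show ?case using snoc[of "t # v'"] isotopic_trans by simp
qed

text \<open>With nothing in between, minimum, crossing and maximum form a kink, which Reidemeister I
  removes for either sign.\<close>

lemma stabilized_closure2: "isotopic (stabilized u [] s [] v) (closure2 (u @ v))"
proof -
  have "local_move [(2, Cup True), (1, Cross s), (2, Cap)] []"
    using local_move.r1_right[of 1] by (simp add: numeral_2_eq_2)
  from isotopic_local_move[OF this, of "[(0, Cup True), (1, Cup True)] @ crossings u"
      "crossings v @ [(1, Cap), (0, Cap)]"]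
  show ?thesis
    using link_diagram_stabilized[of u "[]" s "[]" v] link_diagram_closure2[of "u @ v"]
    by (simp add: stabilized_def closure2_def)
qed

lemma closure_destabilize:
  "isotopic (closure_diagram (map (Pair S1) u @ [(S2, s)] @ map (Pair S1) v)) (closure2 (u @ v))"
proof -
  have "closure_diagram (map (Pair S1) u @ [(S2, s)] @ map (Pair S1) v) = stabilized [] u s v []"
    by (simp add: closure_diagram_def stabilized_def braid_layers_def)
  then show ?thesis
    using stabilized_slide_cup[of u "[]" s v "[]"] stabilized_slide_cap[of u "[]" s v "[]"]
      stabilized_closure2[of u s v]
    by simp (meson isotopic_sym isotopic_trans)
qed

lemma closure2_destabilize: "isotopic (closure2 [s]) [(0, Cup True), (0, Cap)]"
proof -
  have "local_move [(1, Cup True), (0, Cross s), (1, Cap)] []"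
    using local_move.r1_right[of 0] by simp
  from isotopic_local_move[OF this, of "[(0, Cup True)]" "[(0, Cap)]"]
  show ?thesis
    using link_diagram_closure2[of "[s]"] link_diagram_unknot by (simp add: closure2_def)
qed

section \<open>The Conway polynomial of closed 3-braids\<close>

lemma link_of_eqI: "isotopic w w' \<Longrightarrow> link_of w = link_of w'"
  using Quotient3_rel[OF Quotient3_oriented_link] by blast

lemma braid_closure_abs: "braid_closure (abs_braid3 w) = link_of (closure_diagram w)"
  by (simp add: braid_closure.abs_eq)

context
  fixes nabla :: "oriented_link \<Rightarrow> int poly"
  assumes nabla: "is_conway_polynomial nabla"
begin

lemma skein_function_conway: "skein_function z_poly (\<lambda>a. nabla (braid_closure a))"
proof -
  have words: "nabla (link_of (closure_diagram (u @ [(g, True)] @ v)))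
      - nabla (link_of (closure_diagram (u @ [(g, False)] @ v)))
      = z_poly * nabla (link_of (closure_diagram (u @ v)))" for u v g
  proof -
    let ?cups = "[(0, Cup True), (1, Cup True), (2, Cup True)]"
    let ?caps = "[(2, Cap), (1, Cap), (0, Cap)]"
    have "skein_triple ((?cups @ braid_layers u) @ [(gen_pos g, Cross True)] @ braid_layers v @ ?caps)
        ((?cups @ braid_layers u) @ [(gen_pos g, Cross False)] @ braid_layers v @ ?caps)
        ((?cups @ braid_layers u) @ braid_layers v @ ?caps)"
    \<comment> \<open>All braid strands run upwards, so the oriented smoothing just deletes the
      letter.\<close>
    proof (rule skein_triple.parallel)
      show "pass (?cups @ braid_layers u) [] = Some [True, True, True, False, False, False]"
        by (simp add: pass_append pass_braid_layers)
      show "link_diagram ((?cups @ braid_layers u) @ [(gen_pos g, Cross True)] @ braid_layers v @ ?caps)"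
        using link_diagram_closure[of "u @ [(g, True)] @ v"]
        by (simp add: closure_diagram_def braid_layers_def)
    qed (cases g; simp)+
    then show ?thesis
      using nabla by (simp add: is_conway_polynomial_def closure_diagram_def braid_layers_def)
  qed
  have "nabla (braid_closure (a * (abs_braid3 [(g, True)] * b)))
      - nabla (braid_closure (a * (inverse (abs_braid3 [(g, True)]) * b)))
      = z_poly * nabla (braid_closure (a * b))" for a b g
  proof -
    obtain u v where "a = abs_braid3 u" "b = abs_braid3 v"
      by (metis Quotient3_abs_rep Quotient3_braid3)
    then show ?thesis
      using words[of u g v]
      by (simp add: times_braid3.abs_eq inverse_braid3.abs_eq inverse_word_def braid_closure_abs)
  qed
  then show ?thesis
    by (auto simp: skein_function_def \<sigma>\<^sub>1_def \<sigma>\<^sub>2_def)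
qed

lemmas conway_squares = skein_squares[OF skein_function_conway]

text \<open>When both signs of a crossing destabilize to the same link, the skein relation makes
  \<open>z_poly\<close> times the smoothed value vanish; this yields the three zeros.\<close>

lemma conway_permutation_braids:
  "nabla (braid_closure 1) = 0"
  "nabla (braid_closure \<sigma>\<^sub>1) = 0"
  "nabla (braid_closure \<sigma>\<^sub>2) = 0"
  "nabla (braid_closure (\<sigma>\<^sub>1 * \<sigma>\<^sub>2)) = 1"
  "nabla (braid_closure (\<sigma>\<^sub>2 * \<sigma>\<^sub>1)) = 1"
  "nabla (braid_closure (\<sigma>\<^sub>1 * (\<sigma>\<^sub>2 * \<sigma>\<^sub>1))) = z_poly"
proof -
  let ?f = "\<lambda>a. nabla (braid_closure a)"
  have link: "nabla (link_of (closure_diagram (map (Pair S1) u @ [(S2, s)] @ map (Pair S1) v)))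
      = nabla (link_of (closure2 (u @ v)))" for u s v
    using link_of_eqI[OF closure_destabilize] by metis
  have unknot: "nabla (link_of (closure2 [s])) = 1" for s
    using nabla link_of_eqI[OF closure2_destabilize]
    by (simp add: is_conway_polynomial_def unknot_def)
  note abs = \<sigma>\<^sub>1_def \<sigma>\<^sub>2_def inverse_braid3.abs_eq inverse_word_def times_braid3.abs_eq
    braid_closure_abs
  show c12: "?f (\<sigma>\<^sub>1 * \<sigma>\<^sub>2) = 1"
    using link[of "[True]" True "[]"] unknot by (simp add: abs)
  show "?f (\<sigma>\<^sub>2 * \<sigma>\<^sub>1) = 1"
    using link[of "[]" True "[True]"] unknot by (simp add: abs)
  have c1': "?f (\<sigma>\<^sub>1 * inverse \<sigma>\<^sub>2) = 1"
    using link[of "[True]" False "[]"] unknot by (simp add: abs)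
  have c'2: "?f (inverse \<sigma>\<^sub>1 * \<sigma>\<^sub>2) = 1"
    using link[of "[False]" True "[]"] unknot by (simp add: abs)
  note inv = skein_inverse[OF skein_function_conway]
  show c1: "?f \<sigma>\<^sub>1 = 0" using inv[of \<sigma>\<^sub>2 \<sigma>\<^sub>1 1] c12 c1' by simp
  show c2: "?f \<sigma>\<^sub>2 = 0" using inv[of \<sigma>\<^sub>1 1 \<sigma>\<^sub>2] c12 c'2 by simp
  have "?f (inverse \<sigma>\<^sub>2) = 0"
    using link[of "[]" False "[]"] link[of "[]" True "[]"] c2 by (simp add: abs)
  then show "?f 1 = 0" using inv[of \<sigma>\<^sub>2 1 1] c2 by simp
  \<comment> \<open>Both words destabilize to \<open>closure2 [True, True]\<close>, and the second
    contains a square.\<close>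
  have "?f (\<sigma>\<^sub>1 * (\<sigma>\<^sub>2 * \<sigma>\<^sub>1)) = ?f (\<sigma>\<^sub>1 * (\<sigma>\<^sub>1 * \<sigma>\<^sub>2))"
    using link[of "[True]" True "[True]"] link[of "[True, True]" True "[]"] by (simp add: abs)
  also have "\<dots> = z_poly"
    using conway_squares(1)[of 1 \<sigma>\<^sub>2] c2 c12 by simp
  finally show "?f (\<sigma>\<^sub>1 * (\<sigma>\<^sub>2 * \<sigma>\<^sub>1)) = z_poly" .
qed

end

text \<open>With \<open>z\<close> and \<open>F\<close> abstract, comparing the six values is a plain
  polynomial computation.\<close>

lemma skein_full_twist:
  assumes f: "skein_function z f"
    and "f 1 = 0" "f \<sigma>\<^sub>1 = 0" "f \<sigma>\<^sub>2 = 0" "f (\<sigma>\<^sub>1 * \<sigma>\<^sub>2) = 1" "f (\<sigma>\<^sub>2 * \<sigma>\<^sub>1) = 1"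
      "f (\<sigma>\<^sub>1 * (\<sigma>\<^sub>2 * \<sigma>\<^sub>1)) = z"
    and F: "\<And>n. F (n + 2) = z * F (n + 1) + F n" "F 0 = 0" "F 1 = 1"
  shows "f (\<Delta> * \<Delta> * a) - f a = z * F (exponent_sum a + 4) + z * F (exponent_sum a + 2)"
proof (rule skein_function_unique)
  show "skein_function z (\<lambda>a. f (\<Delta> * \<Delta> * a) - f a)"
    using skein_function_diff[OF skein_function_translate[OF f] f] .
  show "skein_function z (\<lambda>a. z * F (exponent_sum a + 4) + z * F (exponent_sum a + 2))"
  proof (rule skein_function_exponent_sum)
    fix n
    show "z * F (n + 2 + 4) + z * F (n + 2 + 2) =
        z * (z * F (n + 1 + 4) + z * F (n + 1 + 2)) + (z * F (n + 4) + z * F (n + 2))"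
      using F(1)[of "n + 4"] F(1)[of "n + 2"] by (simp add: algebra_simps)
  qed
  fix b assume "b \<in> permutation_braids"
  \<comment> \<open>Right nesting hides a square behind a longer prefix, so the rules are
    instantiated with each permutation braid as prefix.\<close>
  note squares = skein_squares[OF f, of 1] skein_squares[OF f, of \<sigma>\<^sub>1] skein_squares[OF f, of \<sigma>\<^sub>2]
    skein_squares[OF f, of "\<sigma>\<^sub>1 * \<sigma>\<^sub>2"] skein_squares[OF f, of "\<sigma>\<^sub>2 * \<sigma>\<^sub>1"]
    skein_squares[OF f, of "\<sigma>\<^sub>1 * (\<sigma>\<^sub>2 * \<sigma>\<^sub>1)"]
  \<comment> \<open>Permutation braids have exponent sums 0 to 3; with the shifts 2 and 4 the
    indices run from 2 to 7.\<close>
  have F_values: "F 2 = z" "F 3 = z * F 2 + 1" "F 4 = z * F 3 + F 2" "F 5 = z * F 4 + F 3"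
    "F 6 = z * F 5 + F 4" "F 7 = z * F 6 + F 5"
    using F(1)[of 0] F(1)[of 1] F(1)[of 2] F(1)[of 3] F(1)[of 4] F(1)[of 5] F(2,3) by simp_all
  from \<open>b \<in> permutation_braids\<close>
  show "f (\<Delta> * \<Delta> * b) - f b = z * F (exponent_sum b + 4) + z * F (exponent_sum b + 2)"
    by (auto simp: \<Delta>_def mult.assoc squares[unfolded mult.assoc mult_1_left] assms(2-7)
        braid3_relation_left braid3_relation_right exponent_sum_one exponent_sum_hom
        exponent_sum_gen F_values algebra_simps)
qed

theorem theorem3p1:
  fixes nabla :: "oriented_link \<Rightarrow> int poly" and \<alpha> \<beta> :: braid3 and k :: nat
  assumes "is_conway_polynomial nabla"
    and "k > 0"
    and "\<beta> = \<Delta> ^ (2 * k) * \<alpha>"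
  shows "nabla (braid_closure \<beta>) - nabla (braid_closure \<alpha>) =
    z_poly * (\<Sum>i = 0..k - 1. fib_poly (exponent_sum \<alpha> + 6 * int i + 4)
                         + fib_poly (exponent_sum \<alpha> + 6 * int i + 2))"
proof -
  let ?f = "\<lambda>a. nabla (braid_closure a)"
  define h where "h i = fib_poly (exponent_sum \<alpha> + 6 * int i + 4)
    + fib_poly (exponent_sum \<alpha> + 6 * int i + 2)" for i
  have "?f (\<Delta> ^ (2 * Suc i) * \<alpha>) - ?f (\<Delta> ^ (2 * i) * \<alpha>) = z_poly * h i" for i
  proof -
    have "exponent_sum (\<Delta> ^ (2 * i) * \<alpha>) = exponent_sum \<alpha> + 6 * int i"
      by (simp add: exponent_sum_hom exponent_sum_power exponent_sum_Delta)
    moreover have "\<Delta> ^ (2 * Suc i) * \<alpha> = \<Delta> * \<Delta> * (\<Delta> ^ (2 * i) * \<alpha>)"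
      by (simp add: mult.assoc)
    ultimately show ?thesis
      using skein_full_twist[OF skein_function_conway[OF assms(1)]
          conway_permutation_braids[OF assms(1)] fib_poly_rec,
          of "\<Delta> ^ (2 * i) * \<alpha>"]
      \<comment> \<open>The premises on \<open>F 0\<close> and \<open>F 1\<close> are still open
        after \<open>OF\<close>; \<open>fib_poly_def\<close> settles them.\<close>
      by (simp only: h_def distrib_left) (simp add: fib_poly_def)
  qed
  then have "(\<Sum>i<k. ?f (\<Delta> ^ (2 * Suc i) * \<alpha>) - ?f (\<Delta> ^ (2 * i) * \<alpha>)) = z_poly * (\<Sum>i<k. h i)"
    by (simp only: sum_distrib_left)
  \<comment> \<open>Here \<open>k > 0\<close> matters: for \<open>k = 0\<close> truncated
    subtraction would give \<open>{0..0}\<close>.\<close>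
  moreover have "{..<k} = {0..k - 1}"
    using assms(2) by auto
  ultimately show ?thesis
    using sum_lessThan_telescope[of "\<lambda>i. ?f (\<Delta> ^ (2 * i) * \<alpha>)" k] assms(3)
    by (simp add: h_def)
qed

end
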